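(* Let $\mathcal{I}$ be an ideal on $\omega$ and let $x = (x_n)$ be a sequence taking values in a first countable topological space $X$. Then $$\Gamma_x(\mathcal{I}) = \bigcap_{B \in \mathcal{B}_x(\mathcal{I})} \overline{B}.$$
   Context: $\omega$ denotes the set of positive integers. An ideal $\mathcal{I}$ on $\omega$ is a family of subsets of $\omega$ closed under finite unions and under taking subsets of its elements, different from the power set of $\omega$ and containing all singletons. $\Gamma_x(\mathcal{I})$ is the set of $\mathcal{I}$-cluster points of $x$, i.e. the set of all $\ell \in X$ such that $\{n : x_n \in U\} \notin \mathcal{I}$ for all neighborhoods $U$ of $\ell$. $\mathcal{B}_x(\mathcal{I}) := \{\{x_n : n \notin I\} : I \in \mathcal{I}\}$, which is a filter base on $X$ (of the filter $\{Y \subseteq X : \{n : x_n \notin Y\} \in \mathcal{I}\}$). $\overline{B}$ denotes the closure of $B$ in $X$. *)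

theory Defs
  imports "HOL-Analysis.Analysis"
begin

text \<open>
  The index set consists of the positive integers. A sequence is a function on \<^typ>\<open>nat\<close>
  of which only the values at positive arguments are ever used; its value at 0 is irrelevant.
\<close>

definition omega :: "nat set" where
  "omega = {1..}"

text \<open>
  Closure under binary unions gives closure under nonempty finite unions; the empty union is
  covered by closure under subsets together with the singletons.
\<close>

definition ideal_on_omega :: "nat set set \<Rightarrow> bool" where
  "ideal_on_omega \<I> \<longleftrightarrow>
     \<I> \<subseteq> Pow omega \<and>
     (\<forall>A\<in>\<I>. \<forall>B\<in>\<I>. A \<union> B \<in> \<I>) \<and>
     (\<forall>A\<in>\<I>. \<forall>B. B \<subseteq> A \<longrightarrow> B \<in> \<I>) \<and>
     \<I> \<noteq> Pow omega \<and>
     (\<forall>n\<in>omega. {n} \<in> \<I>)"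

text \<open>Neighborhoods need not be open.\<close>

definition neighborhood :: "'a topology \<Rightarrow> 'a \<Rightarrow> 'a set \<Rightarrow> bool" where
  "neighborhood X l U \<longleftrightarrow> U \<subseteq> topspace X \<and> (\<exists>V. openin X V \<and> l \<in> V \<and> V \<subseteq> U)"

definition cluster_points :: "'a topology \<Rightarrow> nat set set \<Rightarrow> (nat \<Rightarrow> 'a) \<Rightarrow> 'a set" where
  "cluster_points X \<I> x =
     {l \<in> topspace X. \<forall>U. neighborhood X l U \<longrightarrow> {n \<in> omega. x n \<in> U} \<notin> \<I>}"

definition filter_base :: "nat set set \<Rightarrow> (nat \<Rightarrow> 'a) \<Rightarrow> 'a set set" where
  "filter_base \<I> x = {{x n | n. n \<in> omega \<and> n \<notin> I} | I. I \<in> \<I>}"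

end

theory Submission
  imports Defs
begin

text \<open>
  Both sides say that every open set \<open>V\<close> around \<open>l\<close> is visited by the sequence along an index set
  \<open>A = {n. x n \<in> V}\<close> that the ideal does not contain. On the left this is the definition, once
  neighborhoods are replaced by open ones. On the right, \<open>V\<close> meets the base set attached to
  \<open>I \<in> \<I>\<close> exactly if \<open>A\<close> is not covered by \<open>I\<close>, and a set covered by no member of a
  downward closed family is the same as a set outside that family (\<open>notin_ideal_iff\<close>).
\<close>

lemma notin_ideal_iff:
  assumes "ideal_on_omega \<I>"
  shows "A \<notin> \<I> \<longleftrightarrow> (\<forall>I\<in>\<I>. \<not> A \<subseteq> I)"
proof -
  have "B \<in> \<I>" if "A \<in> \<I>" "B \<subseteq> A" for A B
    using assms that unfolding ideal_on_omega_def by simp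
  then show ?thesis
    by (metis subset_refl)
qed

lemma ideal_nonempty:
  assumes "ideal_on_omega \<I>"
  shows "\<I> \<noteq> {}"
proof -
  have "{1} \<in> \<I>"
    using assms unfolding ideal_on_omega_def omega_def by simp
  then show ?thesis
    by (metis empty_iff)
qed

text \<open>
  Open neighborhoods suffice: shrinking \<open>U\<close> shrinks \<open>{n. x n \<in> U}\<close>, and a superset of a set
  outside the ideal is outside it too.
\<close>

lemma cluster_points_iff_open:
  assumes "ideal_on_omega \<I>"
  shows "l \<in> cluster_points X \<I> x \<longleftrightarrow>
    l \<in> topspace X \<and> (\<forall>V. openin X V \<and> l \<in> V \<longrightarrow> {n \<in> omega. x n \<in> V} \<notin> \<I>)"
    (is "?L \<longleftrightarrow> ?R")
proof
  assume L: ?L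
  have "{n \<in> omega. x n \<in> V} \<notin> \<I>" if "openin X V" "l \<in> V" for V
  proof -
    have "neighborhood X l V"
      using that openin_subset unfolding neighborhood_def by fast
    with L show ?thesis
      unfolding cluster_points_def by simp
  qed
  with L show ?R
    unfolding cluster_points_def by simp
next
  assume R: ?R
  have "{n \<in> omega. x n \<in> U} \<notin> \<I>" if U: "neighborhood X l U" for U
  proof -
    obtain V where V: "openin X V" "l \<in> V" "V \<subseteq> U"
      using U unfolding neighborhood_def by blast
    have "{n \<in> omega. x n \<in> V} \<notin> \<I>"
      using R V by simp
    moreover have "{n \<in> omega. x n \<in> V} \<subseteq> {n \<in> omega. x n \<in> U}"
      using V by blast
    ultimately show ?thesis
      unfolding notin_ideal_iff[OF assms] by (meson subset_trans)
  qed
  with R show ?L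
    unfolding cluster_points_def by simp
qed

lemma closure_of_filter_base_iff:
  assumes "ideal_on_omega \<I>"
  shows "l \<in> (\<Inter>B\<in>filter_base \<I> x. X closure_of B) \<longleftrightarrow>
    l \<in> topspace X \<and> (\<forall>V. openin X V \<and> l \<in> V \<longrightarrow> {n \<in> omega. x n \<in> V} \<notin> \<I>)"
proof -
  have meets: "(\<exists>y. y \<in> {x n | n. n \<in> omega \<and> n \<notin> I} \<and> y \<in> V) \<longleftrightarrow>
      \<not> {n \<in> omega. x n \<in> V} \<subseteq> I" for I V
    by auto
  have "l \<in> (\<Inter>B\<in>filter_base \<I> x. X closure_of B) \<longleftrightarrow>
    (\<forall>I\<in>\<I>. l \<in> X closure_of {x n | n. n \<in> omega \<and> n \<notin> I})"
    unfolding filter_base_def Setcompr_eq_image by simp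
  also have "\<dots> \<longleftrightarrow> (\<forall>I\<in>\<I>. l \<in> topspace X \<and>
      (\<forall>V. openin X V \<and> l \<in> V \<longrightarrow> \<not> {n \<in> omega. x n \<in> V} \<subseteq> I))"
    unfolding in_closure_of meets[symmetric] by (simp only: conj_commute)
  \<comment> \<open>An empty intersection would be all of \<open>UNIV\<close>, possibly larger than the space; the ideal
      being nonempty rules this out.\<close>
  also have "\<dots> \<longleftrightarrow> l \<in> topspace X \<and>
      (\<forall>V. openin X V \<and> l \<in> V \<longrightarrow> (\<forall>I\<in>\<I>. \<not> {n \<in> omega. x n \<in> V} \<subseteq> I))"
    using ideal_nonempty[OF assms] by blast
  finally show ?thesis
    unfolding notin_ideal_iff[OF assms] .
qed

theorem theorem4p2:
  fixes X :: "'a topology" and \<I> :: "nat set set" and x :: "nat \<Rightarrow> 'a"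
  assumes "ideal_on_omega \<I>"
    and "first_countable X"
    and "\<And>n. n \<in> omega \<Longrightarrow> x n \<in> topspace X"
  shows "cluster_points X \<I> x = (\<Inter>B\<in>filter_base \<I> x. X closure_of B)"
  by (rule set_eqI)
    (simp only: cluster_points_iff_open[OF assms(1)] closure_of_filter_base_iff[OF assms(1)])

end
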